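(* For every integer $n\ge 1$, $$\mathrm{pf}_n(231,312,321)=\sum_{k=0}^{\lfloor n/2\rfloor}\frac{1}{n+1}\binom{2n-k}{n+k}\binom{n+k}{k}.$$
   Context: A Dyck path of semilength $n$ is a lattice path from $(0,0)$ to $(n,n)$ consisting of $n$ north steps $N=(0,1)$ and $n$ east steps $E=(1,0)$ that never goes below the line $y=x$. A parking function of size $n$ is a Dyck path of semilength $n$ whose $n$ north steps are labeled bijectively by $\{1,\dots,n\}$ so that whenever two north steps are consecutive in the path (one immediately following the other), the label of the later one is larger. For a parking function $p$ of size $n$, $\phi(p)$ is the permutation of $\{1,\dots,n\}$ (in one-line notation) obtained by reading the labels of the north steps in the order they occur along the path. A permutation $\pi$ of $\{1,\dots,n\}$ contains a permutation $\rho$ of $\{1,\dots,m\}$ if there are indices $1\le i_1<\cdots<i_m\le n$ such that $\pi_{i_a}\le\pi_{i_b}$ if and only if $\rho_a\le\rho_b$; otherwise $\pi$ avoids $\rho$. For permutations $\rho_1,\dots,\rho_r$, $\mathrm{pf}_n(\rho_1,\dots,\rho_r)$ denotes the number of parking functions $p$ of size $n$ such that $\phi(p)$ avoids each of $\rho_1,\dots,\rho_r$. *)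

theory Defs
  imports Complex_Main
begin

text \<open>
  A lattice path is a list of steps. North steps carry a label; the underlying unlabelled
  path is obtained by forgetting the labels, and \<open>dyck_path\<close> depends on that path only.
\<close>

datatype 'l step = is_North: North (label: 'l) | is_East: East

definition norths :: "'l step list \<Rightarrow> nat" where
  "norths w = length (filter is_North w)"

definition easts :: "'l step list \<Rightarrow> nat" where
  "easts w = length (filter is_East w)"

text \<open>The path \<open>w\<close> visits the lattice points \<open>(easts (take i w), norths (take i w))\<close>.\<close>

definition dyck_path :: "nat \<Rightarrow> 'l step list \<Rightarrow> bool" where
  "dyck_path n w \<longleftrightarrow> norths w = n \<and> easts w = n \<and>
     (\<forall>i\<le>length w. easts (take i w) \<le> norths (take i w))"

definition phi :: "'l step list \<Rightarrow> 'l list" where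
  "phi w = map label (filter is_North w)"

definition parking_function :: "nat \<Rightarrow> nat step list \<Rightarrow> bool" where
  "parking_function n w \<longleftrightarrow> dyck_path n w \<and>
     distinct (phi w) \<and> set (phi w) = {1..n} \<and>
     (\<forall>i a b. Suc i < length w \<longrightarrow> w ! i = North a \<longrightarrow> w ! Suc i = North b \<longrightarrow> a < b)"

text \<open>Permutations are lists in one-line notation, indexed from 0.\<close>

definition contains :: "nat list \<Rightarrow> nat list \<Rightarrow> bool" where
  "contains \<pi> \<rho> \<longleftrightarrow> (\<exists>i. strict_mono_on {..<length \<rho>} i \<and>
     (\<forall>a<length \<rho>. i a < length \<pi>) \<and>
     (\<forall>a<length \<rho>. \<forall>b<length \<rho>. \<pi> ! i a \<le> \<pi> ! i b \<longleftrightarrow> \<rho> ! a \<le> \<rho> ! b))"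

definition avoids :: "nat list \<Rightarrow> nat list \<Rightarrow> bool" where
  "avoids \<pi> \<rho> \<longleftrightarrow> \<not> contains \<pi> \<rho>"

definition pf :: "nat \<Rightarrow> nat list set \<Rightarrow> nat" where
  "pf n R = card {w. parking_function n w \<and> (\<forall>\<rho>\<in>R. avoids (phi w) \<rho>)}"

end

theory Submission
  imports Defs "HOL-Computational_Algebra.Formal_Power_Series"
begin

text \<open>
  A permutation avoids 231, 312 and 321 iff it is a product of disjoint transpositions of
  neighbouring positions, applied to the identity. So the last label of a path is either the
  largest one, or the last two labels are \<open>m\<close>, \<open>m - 1\<close> and at least one east step
  separates them. Removing the last step, or the whole last transposition, gives a recurrence for
  the number of prefixes with \<open>m\<close> north steps ending at height \<open>h\<close> above the diagonal. It is
  solved by the coefficients of \<open>A (1 - 1 / A)\<^sup>h\<close>, where \<open>A = 1 + X A\<^sup>2 + X\<^sup>2 A\<^sup>3\<close>. At \<open>h = 0\<close>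
  this is \<open>A\<close>, and since \<open>X A\<close> is the compositional inverse of \<open>X (1 - X - X\<^sup>2)\<close>, Lagrange inversion
  gives its \<open>n\<close>-th coefficient as that of \<open>G ^ (n + 1) / (n + 1)\<close> with \<open>G = 1 / (1 - X - X\<^sup>2)\<close>.
\<close>

subsection \<open>Structure of the paths\<close>

text \<open>Every inversion is between neighbouring positions: an entry between the two ends of an
  inversion completes one of the three forbidden patterns, and each of them inverts its ends.\<close>
definition near_sorted :: "nat list \<Rightarrow> bool" where
  "near_sorted \<pi> \<longleftrightarrow> (\<forall>i j. i + 2 \<le> j \<and> j < length \<pi> \<longrightarrow> \<pi> ! i < \<pi> ! j)"

lemma contains_triple_iff:
  "contains \<pi> [x, y, z] \<longleftrightarrow> (\<exists>i j k. i < j \<and> j < k \<and> k < length \<pi> \<and>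
     (\<pi> ! i \<le> \<pi> ! j \<longleftrightarrow> x \<le> y) \<and> (\<pi> ! j \<le> \<pi> ! i \<longleftrightarrow> y \<le> x) \<and>
     (\<pi> ! i \<le> \<pi> ! k \<longleftrightarrow> x \<le> z) \<and> (\<pi> ! k \<le> \<pi> ! i \<longleftrightarrow> z \<le> x) \<and>
     (\<pi> ! j \<le> \<pi> ! k \<longleftrightarrow> y \<le> z) \<and> (\<pi> ! k \<le> \<pi> ! j \<longleftrightarrow> z \<le> y))"
  (is "?L \<longleftrightarrow> ?R")
proof
  assume ?L
  then obtain i where m: "strict_mono_on {..<3} i" and l: "\<forall>a<3. i a < length \<pi>"
    and o: "\<forall>a<3. \<forall>b<3. \<pi> ! i a \<le> \<pi> ! i b \<longleftrightarrow> [x, y, z] ! a \<le> [x, y, z] ! b"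
    unfolding contains_def by (auto simp: numeral_3_eq_3)
  have "i 0 < i 1" "i 1 < i 2" using m by (auto simp: strict_mono_on_def)
  moreover have "i 2 < length \<pi>" using l by simp
  moreover have "(0::nat) < 3" "(1::nat) < 3" "(2::nat) < 3" by simp_all
  moreover have "[x, y, z] ! 0 = x" "[x, y, z] ! 1 = y" "[x, y, z] ! 2 = z" by simp_all
  ultimately show ?R using o by metis
next
  assume ?R
  then obtain i j k where h: "i < j" "j < k" "k < length \<pi>"
     "\<pi> ! i \<le> \<pi> ! j \<longleftrightarrow> x \<le> y" "\<pi> ! j \<le> \<pi> ! i \<longleftrightarrow> y \<le> x"
     "\<pi> ! i \<le> \<pi> ! k \<longleftrightarrow> x \<le> z" "\<pi> ! k \<le> \<pi> ! i \<longleftrightarrow> z \<le> x"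
     "\<pi> ! j \<le> \<pi> ! k \<longleftrightarrow> y \<le> z" "\<pi> ! k \<le> \<pi> ! j \<longleftrightarrow> z \<le> y" by blast
  have "strict_mono_on {..<length [x, y, z]} ((!) [i, j, k])"
    using h(1,2) by (auto simp: strict_mono_on_def less_Suc_eq)
  then show ?L unfolding contains_def
    by (intro exI[of _ "(!) [i, j, k]"]) (use h(1-3) in \<open>simp add: All_less_Suc h(4-9)\<close>)
qed

lemma avoids_231_312_321_iff:
  assumes "distinct \<pi>"
  shows "(\<forall>\<rho>\<in>{[2, 3, 1], [3, 1, 2], [3, 2, 1]}. avoids \<pi> \<rho>) \<longleftrightarrow> near_sorted \<pi>"
proof -
  have neq: "i < j \<Longrightarrow> j < length \<pi> \<Longrightarrow> \<pi> ! i \<noteq> \<pi> ! j" for i j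
    using assms by (simp add: nth_eq_iff_index_eq)
  show ?thesis
  proof
    assume av: "\<forall>\<rho>\<in>{[2, 3, 1], [3, 1, 2], [3, 2, 1]}. avoids \<pi> \<rho>"
    show "near_sorted \<pi>" unfolding near_sorted_def
    proof (intro allI impI, rule ccontr)
      fix i k assume ik: "i + 2 \<le> k \<and> k < length \<pi>" and "\<not> \<pi> ! i < \<pi> ! k"
      moreover have "\<pi> ! i \<noteq> \<pi> ! k" "\<pi> ! i \<noteq> \<pi> ! Suc i" "\<pi> ! Suc i \<noteq> \<pi> ! k"
        using ik neq[of i k] neq[of i "Suc i"] neq[of "Suc i" k] by auto
      \<comment> \<open>\<open>Suc i\<close> is taken as the middle position: an entry there above
        both ends gives 231, between them 321, below both 312.\<close>
      moreover have "i < Suc i" "Suc i < k" "k < length \<pi>" using ik by auto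
      moreover have no: "\<not> contains \<pi> [2, 3, 1]" "\<not> contains \<pi> [3, 1, 2]" "\<not> contains \<pi> [3, 2, 1]"
        using av by (auto simp: avoids_def)
      ultimately show False
        using no[unfolded contains_triple_iff not_ex, THEN spec[of _ i], THEN spec[of _ "Suc i"], THEN spec[of _ k]]
        by auto
    qed
  next
    assume "near_sorted \<pi>"
    then have "\<pi> ! i < \<pi> ! k" if "i < j" "j < k" "k < length \<pi>" for i j k
      using that unfolding near_sorted_def by auto
    then show "\<forall>\<rho>\<in>{[2, 3, 1], [3, 1, 2], [3, 2, 1]}. avoids \<pi> \<rho>"
      by (fastforce simp: avoids_def contains_triple_iff)
  qed
qed

text \<open>Only the immediate predecessor of the new entry may exceed it, hence
  \<open>butlast\<close>.\<close>

lemma near_sorted_snoc: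
  "near_sorted (\<sigma> @ [a]) \<longleftrightarrow> near_sorted \<sigma> \<and> (\<forall>x\<in>set (butlast \<sigma>). x < a)"
proof -
  have "near_sorted (\<sigma> @ [a]) \<longleftrightarrow> near_sorted \<sigma> \<and> (\<forall>i. i + 2 \<le> length \<sigma> \<longrightarrow> \<sigma> ! i < a)"
  proof (intro iffI conjI allI impI)
    assume L: "near_sorted (\<sigma> @ [a])"
    then show "near_sorted \<sigma>"
      unfolding near_sorted_def by (fastforce simp: nth_append)
    fix i assume "i + 2 \<le> length \<sigma>"
    then show "\<sigma> ! i < a"
      using L[unfolded near_sorted_def, rule_format, of i "length \<sigma>"] by (simp add: nth_append)
  next
    assume "near_sorted \<sigma> \<and> (\<forall>i. i + 2 \<le> length \<sigma> \<longrightarrow> \<sigma> ! i < a)"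
    then show "near_sorted (\<sigma> @ [a])"
      unfolding near_sorted_def by (auto simp: nth_append less_Suc_eq)
  qed
  also have "(\<forall>i. i + 2 \<le> length \<sigma> \<longrightarrow> \<sigma> ! i < a) \<longleftrightarrow> (\<forall>x\<in>set (butlast \<sigma>). x < a)"
    by (auto simp: all_set_conv_all_nth nth_butlast)
  finally show ?thesis .
qed

text \<open>Entries before the last two lie below \<open>a\<close>. If \<open>a < m\<close>, this
  leaves only the next-to-last place for \<open>m\<close>, and then only the last one for
  \<open>m - 1\<close>.\<close>

lemma near_sorted_perm_last:
  assumes "near_sorted (\<sigma> @ [a])" "distinct (\<sigma> @ [a])" "set (\<sigma> @ [a]) = {1..m}"
  obtains "a = m" | \<tau> where "\<sigma> = \<tau> @ [m]" "m = Suc a" "1 \<le> a"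
proof (cases "a = m")
  case False
  have "a \<in> {1..m}" unfolding assms(3)[symmetric] by simp
  with False have a: "1 \<le> a" "a < m" by auto
  then have mem: "m \<in> set \<sigma>" "m - 1 \<in> set (\<sigma> @ [a])" using assms(3) by auto
  then have ne: "\<sigma> \<noteq> []" by auto
  have bl: "\<forall>x\<in>set (butlast \<sigma>). x < a" using assms(1) by (simp add: near_sorted_snoc)
  have s: "set \<sigma> = set (butlast \<sigma>) \<union> {last \<sigma>}"
    using ne by (metis append_butlast_last_id list.set(1) list.simps(15) set_append)
  then have "last \<sigma> = m" using mem(1) bl a by fastforce
  moreover from this have "m - 1 = a" using mem(2) bl s a by fastforce
  ultimately show ?thesis using that(2)[of "butlast \<sigma>"] ne a by (metis Suc_diff_1 append_butlast_last_id gr_zeroI less_zeroE)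
qed (use that in blast)

section \<open>Prefixes of labelled Dyck paths\<close>

definition dyck_prefix :: "'l step list \<Rightarrow> bool" where
  "dyck_prefix w \<longleftrightarrow> (\<forall>i\<le>length w. easts (take i w) \<le> norths (take i w))"

definition increasing_runs :: "nat step list \<Rightarrow> bool" where
  "increasing_runs w \<longleftrightarrow>
     (\<forall>i a b. Suc i < length w \<longrightarrow> w ! i = North a \<longrightarrow> w ! Suc i = North b \<longrightarrow> a < b)"

lemma step_count_simps [simp]:
  "norths [] = 0" "easts [] = 0" "phi [] = []"
  "norths (u @ v) = norths u + norths v" "easts (u @ v) = easts u + easts v" "phi (u @ v) = phi u @ phi v"
  "norths (North a # w) = Suc (norths w)" "easts (North a # w) = easts w" "phi (North a # w) = a # phi w"
  "norths (East # w) = norths w" "easts (East # w) = Suc (easts w)" "phi (East # w) = phi w"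
  "norths (replicate b East) = 0" "easts (replicate b East) = b" "phi (replicate b East) = []"
  by (simp_all add: norths_def easts_def phi_def)

lemma length_phi [simp]: "length (phi w) = norths w"
  by (simp add: phi_def norths_def)

lemma North_mem_phi: "North a \<in> set w \<Longrightarrow> a \<in> set (phi w)"
  by (force simp: phi_def)

lemma dyck_prefix_Nil [simp]: "dyck_prefix []"
  by (simp add: dyck_prefix_def)

lemma dyck_prefix_snoc [simp]:
  "dyck_prefix (w @ [s]) \<longleftrightarrow> dyck_prefix w \<and> easts (w @ [s]) \<le> norths (w @ [s])"
  unfolding dyck_prefix_def by (auto simp: le_Suc_eq simp del: step_count_simps)

lemma dyck_prefix_le: "dyck_prefix w \<Longrightarrow> easts w \<le> norths w"
  unfolding dyck_prefix_def by auto

lemma increasing_runs_Nil [simp]: "increasing_runs []"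
  by (simp add: increasing_runs_def)

lemma increasing_runs_snoc:
  "increasing_runs (w @ [s]) \<longleftrightarrow> increasing_runs w \<and>
     (\<forall>a b. w \<noteq> [] \<longrightarrow> last w = North a \<longrightarrow> s = North b \<longrightarrow> a < b)"
proof -
  have "(\<forall>i a b. Suc i < length (w @ [s]) \<longrightarrow> (w @ [s]) ! i = North a \<longrightarrow> (w @ [s]) ! Suc i = North b \<longrightarrow> a < b)
     \<longleftrightarrow> (\<forall>i a b. Suc i < length w \<longrightarrow> w ! i = North a \<longrightarrow> w ! Suc i = North b \<longrightarrow> a < b) \<and>
     (\<forall>i a b. Suc i = length w \<longrightarrow> w ! i = North a \<longrightarrow> s = North b \<longrightarrow> a < b)"
    by (auto simp: nth_append less_Suc_eq)
  also have "(\<forall>i a b. Suc i = length w \<longrightarrow> w ! i = North a \<longrightarrow> s = North b \<longrightarrow> a < b) \<longleftrightarrow>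
     (\<forall>a b. w \<noteq> [] \<longrightarrow> last w = North a \<longrightarrow> s = North b \<longrightarrow> a < b)"
    by (cases w rule: rev_cases) (auto simp: nth_append)
  finally show ?thesis unfolding increasing_runs_def .
qed

lemma dyck_prefix_append_easts:
  "dyck_prefix (w @ replicate b East) \<longleftrightarrow> dyck_prefix w \<and> easts w + b \<le> norths w"
proof (induction b)
  case (Suc b)
  have "w @ replicate (Suc b) East = (w @ replicate b East) @ [East]"
    by (simp add: replicate_append_same)
  then show ?case using Suc.IH by (simp only: dyck_prefix_snoc) auto
qed (auto dest: dyck_prefix_le)

lemma increasing_runs_append_easts:
  "increasing_runs (w @ replicate b East) \<longleftrightarrow> increasing_runs w"
proof (induction b)
  case (Suc b)
  have "w @ replicate (Suc b) East = (w @ replicate b East) @ [East]"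
    by (simp add: replicate_append_same)
  then show ?case using Suc.IH by (simp only: increasing_runs_snoc) auto
qed simp

lemma phi_snoc_cases:
  assumes "phi w = \<sigma> @ [a]"
  obtains u b where "w = u @ North a # replicate b East" "phi u = \<sigma>"
  using assms
proof (induction w arbitrary: thesis rule: rev_induct)
  case (snoc s w)
  show ?case
  proof (cases s)
    case (North c)
    then show ?thesis using snoc.prems(1)[of w 0] snoc.prems(2) by simp
  next
    case East
    then have "phi w = \<sigma> @ [a]" using snoc.prems(2) by simp
    then obtain u b where "w = u @ North a # replicate b East" "phi u = \<sigma>"
      using snoc.IH by blast
    then show ?thesis using snoc.prems(1)[of u "Suc b"] East by (simp add: replicate_append_same)
  qed
qed simp

text \<open>The labels have to fill an initial interval. Cutting between the two labels of a
  transposition would break this, so a transposition is always removed as a whole.\<close>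

definition valid_prefix :: "nat step list \<Rightarrow> bool" where
  "valid_prefix w \<longleftrightarrow> dyck_prefix w \<and> increasing_runs w \<and> distinct (phi w) \<and>
     set (phi w) = {1..norths w} \<and> near_sorted (phi w)"

text \<open>The parameter \<open>h\<close> is the height of the end point above the diagonal.\<close>
definition valid_prefixes :: "nat \<Rightarrow> nat \<Rightarrow> nat step list set" where
  "valid_prefixes m h = {w. valid_prefix w \<and> norths w = m \<and> easts w + h = m}"

text \<open>The transposition puts \<open>l + 2\<close> before \<open>l + 1\<close>, a descent, so
  the two north steps need an east step between them; \<open>i\<close> counts the additional ones.
  East steps after the tile do not belong to it.\<close>

definition swap_tile :: "nat \<Rightarrow> nat \<Rightarrow> nat step list \<Rightarrow> nat step list" where
  "swap_tile l i u = u @ North (l + 2) # replicate (Suc i) East @ [North (Suc l)]"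

lemma valid_prefix_Nil: "valid_prefix []"
  by (simp add: valid_prefix_def near_sorted_def)

lemma valid_prefix_snoc_East:
  "valid_prefix (w @ [East]) \<longleftrightarrow> valid_prefix w \<and> easts w < norths w"
  by (auto simp: valid_prefix_def increasing_runs_snoc)

lemma insert_interval_eq:
  "Suc m \<notin> A \<Longrightarrow> insert (Suc m) A = {1..Suc m} \<longleftrightarrow> A = {1..m}"
  by (simp add: atLeastAtMostSuc_conv insert_ident)

text \<open>A label above all earlier ones creates no inversion, and a north step only raises the
  path.\<close>

lemma valid_prefix_snoc_max:
  "valid_prefix (w @ [North (Suc (norths w))]) \<longleftrightarrow> valid_prefix w"
proof
  assume v: "valid_prefix (w @ [North (Suc (norths w))])"
  then have "set (phi w) = {1..norths w}"
    by (intro insert_interval_eq[THEN iffD1, of "norths w" "set (phi w)"]) (auto simp: valid_prefix_def)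
  with v show "valid_prefix w"
    by (auto simp: valid_prefix_def increasing_runs_snoc near_sorted_snoc)
next
  assume v: "valid_prefix w"
  then have lt: "x < Suc (norths w)" if "x \<in> set (phi w)" for x
    using that by (auto simp: valid_prefix_def)
  then have "last w = North a \<Longrightarrow> w \<noteq> [] \<Longrightarrow> a < Suc (norths w)" for a
    by (metis North_mem_phi last_in_set)
  moreover have "x < Suc (norths w)" if "x \<in> set (butlast (phi w))" for x
    using that lt by (meson in_set_butlastD)
  ultimately show "valid_prefix (w @ [North (Suc (norths w))])"
    using v lt dyck_prefix_le[of w]
    by (auto simp: valid_prefix_def increasing_runs_snoc near_sorted_snoc)
qed

lemma valid_prefix_swap_tile:
  assumes "norths u = l"
  shows "valid_prefix (swap_tile l i u) \<longleftrightarrow> valid_prefix u \<and> easts u + i \<le> l"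
proof -
  let ?v = "u @ [North (l + 2)]"
  have w: "swap_tile l i u = (?v @ replicate (Suc i) East) @ [North (Suc l)]"
    by (simp add: swap_tile_def)
  \<comment> \<open>The critical point is just before the last north step: \<open>l + 1\<close>
    north steps against \<open>easts u + i + 1\<close> east steps.\<close>
  have d: "dyck_prefix (swap_tile l i u) \<longleftrightarrow> dyck_prefix u \<and> easts u + i \<le> l"
    unfolding w dyck_prefix_snoc dyck_prefix_append_easts using assms by (auto dest: dyck_prefix_le)
  have "increasing_runs (swap_tile l i u) \<longleftrightarrow> increasing_runs ?v"
    unfolding w by (subst increasing_runs_snoc, subst increasing_runs_append_easts) simp
  then have r: "increasing_runs (swap_tile l i u) \<longleftrightarrow>
      increasing_runs u \<and> (\<forall>a. u \<noteq> [] \<longrightarrow> last u = North a \<longrightarrow> a < l + 2)"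
    by (simp add: increasing_runs_snoc)
  have p: "phi (swap_tile l i u) = phi u @ [l + 2, Suc l]" "norths (swap_tile l i u) = l + 2"
    by (simp_all add: swap_tile_def assms)
  have n: "near_sorted (phi u @ [l + 2, Suc l]) \<longleftrightarrow> near_sorted (phi u) \<and> (\<forall>x\<in>set (phi u). x < Suc l)"
    using near_sorted_snoc[of "phi u @ [l + 2]" "Suc l"] near_sorted_snoc[of "phi u" "l + 2"]
    by (auto dest: in_set_butlastD simp: less_Suc_eq)
  have s: "distinct (phi u @ [l + 2, Suc l]) \<and> set (phi u @ [l + 2, Suc l]) = {1..l + 2} \<longleftrightarrow>
      distinct (phi u) \<and> set (phi u) = {1..l}"
    using insert_interval_eq[of "Suc l" "insert (Suc l) (set (phi u))"]
      insert_interval_eq[of l "set (phi u)"] by auto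
  have lt: "u \<noteq> [] \<longrightarrow> last u = North a \<longrightarrow> a < l + 2" if "set (phi u) = {1..l}" for a
    using that North_mem_phi[of a u] last_in_set[of u] by fastforce
  show ?thesis unfolding valid_prefix_def d r p n
    using s lt assms by (auto simp: less_Suc_eq_le)
qed

lemma valid_prefix_cases:
  assumes "valid_prefix w"
  obtains (Nil) "w = []"
    | (East) u where "w = u @ [East]" "valid_prefix u"
    | (North) u where "w = u @ [North (Suc (norths u))]" "valid_prefix u"
    | (Swap) u i where "w = swap_tile (norths u) i u" "valid_prefix u"
proof (cases w rule: rev_cases)
  case (snoc u s)
  show ?thesis
  proof (cases s)
    case East
    with assms snoc that(2) show ?thesis by (simp add: valid_prefix_snoc_East)
  next
    case (North a)
    have v: "near_sorted (phi u @ [a])" "distinct (phi u @ [a])" "set (phi u @ [a]) = {1..Suc (norths u)}"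
      using assms by (auto simp: valid_prefix_def snoc North)
    from v show ?thesis
    proof (cases rule: near_sorted_perm_last)
      case 1
      with assms that(3)[of u] snoc North show ?thesis by (simp add: valid_prefix_snoc_max)
    next
      case (2 \<tau>)
      then obtain t b where u: "u = t @ North (Suc (norths u)) # replicate b East" "phi t = \<tau>"
        by (metis phi_snoc_cases)
      have nt: "norths u = Suc (norths t)"
        by (subst u(1)) simp
      \<comment> \<open>Without an east step in between, \<open>m\<close> and \<open>m - 1\<close>
        would label consecutive north steps in decreasing order.\<close>
      have "b \<noteq> 0"
      proof
        assume "b = 0"
        then have "last u = North (Suc (norths u))" "u \<noteq> []" by (subst u(1), simp)+
        moreover have "increasing_runs (u @ [North a])"
          using assms by (simp add: valid_prefix_def snoc North)
        ultimately show False using 2 by (auto simp: increasing_runs_snoc)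
      qed
      then obtain i where b: "b = Suc i" by (cases b) auto
      have w: "w = swap_tile (norths t) i t"
        unfolding snoc North swap_tile_def using u(1) 2 nt b by simp
      with assms that(4)[of t i] show ?thesis by (simp add: valid_prefix_swap_tile)
    qed
  qed
qed (use that in blast)

section \<open>Recurrence for the sets of prefixes\<close>

lemma valid_prefixes_empty: "m < h \<Longrightarrow> valid_prefixes m h = {}"
  by (auto simp: valid_prefixes_def)

lemma valid_prefixes_0_0: "valid_prefixes 0 0 = {[]}"
proof -
  have "w = []" if "norths w = 0" "easts w = 0" for w :: "nat step list"
    using that by (cases w; cases "hd w") auto
  then show ?thesis by (auto simp: valid_prefixes_def valid_prefix_Nil)
qed

text \<open>A north step ends strictly above the diagonal, so a nonempty path ending on the diagonal
  ends with an east step.\<close>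

lemma valid_prefixes_Suc_0:
  "valid_prefixes (Suc k) 0 = (\<lambda>w. w @ [East]) ` valid_prefixes (Suc k) 1"
proof (intro equalityI subsetI)
  fix w assume w: "w \<in> valid_prefixes (Suc k) 0"
  then have "valid_prefix w" by (simp add: valid_prefixes_def)
  then show "w \<in> (\<lambda>w. w @ [East]) ` valid_prefixes (Suc k) 1"
  proof (cases rule: valid_prefix_cases)
    case (East u)
    then show ?thesis using w by (auto simp: valid_prefixes_def)
  next
    case (North u)
    then show ?thesis
      using w dyck_prefix_le[of u] by (auto simp: valid_prefixes_def valid_prefix_def)
  next
    case (Swap u i)
    then have "easts u + i \<le> norths u"
      using w valid_prefix_swap_tile[of u "norths u" i] by (simp add: valid_prefixes_def)
    then show ?thesis using w Swap by (simp add: valid_prefixes_def swap_tile_def)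
  qed (use w in \<open>simp add: valid_prefixes_def\<close>)
qed (auto simp: valid_prefixes_def valid_prefix_snoc_East)

text \<open>Removing a tile takes away two north and \<open>i + 1\<close> east steps, so height
  \<open>h + 1\<close> becomes \<open>h + i\<close>. The union over \<open>{l. k = Suc l}\<close> is
  empty for \<open>k = 0\<close>, and the bound on \<open>i\<close> loses nothing, as prefixes with
  \<open>l\<close> north steps have height at most \<open>l\<close>.\<close>

lemma valid_prefixes_Suc_Suc:
  "valid_prefixes (Suc k) (Suc h) =
     (\<lambda>w. w @ [East]) ` valid_prefixes (Suc k) (Suc (Suc h)) \<union>
     (\<lambda>w. w @ [North (Suc k)]) ` valid_prefixes k h \<union>
     (\<Union>l\<in>{l. k = Suc l}. (\<lambda>(i, u). swap_tile l i u) ` (SIGMA i:{..l}. valid_prefixes l (h + i)))"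
  (is "?L = ?E \<union> ?N \<union> ?S")
proof (intro equalityI subsetI)
  fix w assume w: "w \<in> ?L"
  then have "valid_prefix w" by (simp add: valid_prefixes_def)
  then show "w \<in> ?E \<union> ?N \<union> ?S"
  proof (cases rule: valid_prefix_cases)
    case Nil
    then show ?thesis using w by (simp add: valid_prefixes_def)
  next
    case (East u)
    then have "w \<in> ?E" using w by (auto simp: valid_prefixes_def)
    then show ?thesis by blast
  next
    case (North u)
    then have "w \<in> ?N" using w by (auto simp: valid_prefixes_def)
    then show ?thesis by blast
  next
    case (Swap u i)
    define l where "l = norths u"
    have "k = Suc l" "u \<in> valid_prefixes l (h + i)" "i \<le> l"
      using w Swap by (auto simp: valid_prefixes_def swap_tile_def l_def)
    then have "w \<in> ?S" using Swap by (auto simp: l_def[symmetric])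
    then show ?thesis by blast
  qed
next
  fix w assume "w \<in> ?E \<union> ?N \<union> ?S"
  then consider "w \<in> ?E" | "w \<in> ?N" | "w \<in> ?S" by blast
  then show "w \<in> ?L"
  proof cases
    case 1
    then show ?thesis by (auto simp: valid_prefixes_def valid_prefix_snoc_East)
  next
    case 2
    then show ?thesis using valid_prefix_snoc_max by (auto simp: valid_prefixes_def)
  next
    case 3
    then obtain l i u where "k = Suc l" "u \<in> valid_prefixes l (h + i)" "w = swap_tile l i u" by auto
    then show ?thesis
      using valid_prefix_swap_tile[of u l i] by (auto simp: valid_prefixes_def swap_tile_def)
  qed
qed

lemma inj_swap_tile: "inj (\<lambda>(i, u). swap_tile l i u)"
proof (rule injI, clarify)
  fix i u j v assume eq: "swap_tile l i u = swap_tile l j v"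
  \<comment> \<open>Read backwards, the tile is one north step, a run of east steps, and a north
    step that stops the run. This recovers \<open>u\<close>, and the length then gives
    \<open>i\<close>.\<close>
  have "dropWhile is_East (tl (rev (swap_tile l i u))) = North (l + 2) # rev u" for i u
    by (simp add: swap_tile_def dropWhile_append del: replicate.simps)
  with eq have "u = v" by (metis list.inject rev_rev_ident)
  with eq show "i = j \<and> u = v" using arg_cong[OF eq, of length] by (simp add: swap_tile_def)
qed

lemma card_valid_prefixes_Suc_Suc:
  assumes "finite (valid_prefixes (Suc k) (Suc (Suc h)))" "finite (valid_prefixes k h)"
    and "\<And>l i. k = Suc l \<Longrightarrow> finite (valid_prefixes l (h + i))"
  shows "finite (valid_prefixes (Suc k) (Suc h))"
    and "card (valid_prefixes (Suc k) (Suc h)) =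
      card (valid_prefixes (Suc k) (Suc (Suc h))) + card (valid_prefixes k h) +
      (case k of 0 \<Rightarrow> 0 | Suc l \<Rightarrow> \<Sum>i\<le>l. card (valid_prefixes l (h + i)))"
proof -
  define E where "E = (\<lambda>w. w @ [East]) ` valid_prefixes (Suc k) (Suc (Suc h))"
  define N where "N = (\<lambda>w. w @ [North (Suc k)]) ` valid_prefixes k h"
  define S where "S = (\<Union>l\<in>{l. k = Suc l}.
    (\<lambda>(i, u). swap_tile l i u) ` (SIGMA i:{..l}. valid_prefixes l (h + i)))"
  have eq: "valid_prefixes (Suc k) (Suc h) = E \<union> N \<union> S"
    unfolding E_def N_def S_def by (rule valid_prefixes_Suc_Suc)
  have S: "finite S" "card S = (case k of 0 \<Rightarrow> 0 | Suc l \<Rightarrow> \<Sum>i\<le>l. card (valid_prefixes l (h + i)))"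
    using assms(3) by (cases k; auto simp: S_def card_image inj_on_subset[OF inj_swap_tile])+
  have E: "finite E" "card E = card (valid_prefixes (Suc k) (Suc (Suc h)))"
    and N: "finite N" "card N = card (valid_prefixes k h)"
    using assms by (auto simp: E_def N_def card_image inj_on_def)
  \<comment> \<open>The last step tells the sets apart: an east step, label \<open>Suc k\<close>, or
    label \<open>Suc l = k\<close>.\<close>
  have "E \<inter> N = {}" "(E \<union> N) \<inter> S = {}"
    by (auto simp: E_def N_def S_def swap_tile_def)
  then show "finite (valid_prefixes (Suc k) (Suc h))"
    and "card (valid_prefixes (Suc k) (Suc h)) =
      card (valid_prefixes (Suc k) (Suc (Suc h))) + card (valid_prefixes k h) +
      (case k of 0 \<Rightarrow> 0 | Suc l \<Rightarrow> \<Sum>i\<le>l. card (valid_prefixes l (h + i)))"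
    unfolding eq S(2)[symmetric] using E N S(1) by (auto simp: card_Un_disjoint)
qed

lemma pf_231_312_321_eq_card: "pf n {[2,3,1], [3,1,2], [3,2,1]} = card (valid_prefixes n 0)"
proof -
  have "parking_function n w \<and> (\<forall>\<rho>\<in>{[2,3,1], [3,1,2], [3,2,1]}. avoids (phi w) \<rho>) \<longleftrightarrow>
      w \<in> valid_prefixes n 0" for w
  proof (cases "distinct (phi w)")
    case True
    show ?thesis
      unfolding avoids_231_312_321_iff[OF True] parking_function_def dyck_path_def
        valid_prefixes_def valid_prefix_def dyck_prefix_def increasing_runs_def by auto
  qed (auto simp: parking_function_def valid_prefixes_def valid_prefix_def)
  then show ?thesis by (simp add: pf_def)
qed

subsection \<open>Generating functions\<close>

definition fib_fps :: "real fps" where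
  "fib_fps = inverse (1 - fps_X - fps_X\<^sup>2)"

lemma fib_fps_inverse: "fib_fps * (1 - fps_X - fps_X\<^sup>2) = 1"
  unfolding fib_fps_def by (rule inverse_mult_eq_1) simp

text \<open>The coefficient of \<open>X^n\<close> in \<open>G^(q + 1)\<close>: expand it as the sum
  over \<open>j\<close> of \<open>((q + j) choose q) * (X + X^2)^j\<close>, with
  \<open>j = n - k\<close> factors of which \<open>k\<close> contribute \<open>X^2\<close>.\<close>

definition fib_conv :: "nat \<Rightarrow> nat \<Rightarrow> nat" where
  "fib_conv q n = (\<Sum>k\<le>n. ((q + n - k) choose q) * ((n - k) choose k))"

lemma fib_conv_0_rec: "fib_conv 0 (Suc (Suc n)) = fib_conv 0 (Suc n) + fib_conv 0 n"
proof -
  have "fib_conv 0 (Suc (Suc n)) = (\<Sum>k\<le>Suc n. (Suc (Suc n) - k) choose k)"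
    by (simp add: fib_conv_def)
  also have "\<dots> = 1 + (\<Sum>k\<le>n. Suc (n - k) choose Suc k)"
    by (subst sum.atMost_Suc_shift) (auto intro!: sum.cong simp: Suc_diff_le)
  also have "\<dots> = (1 + (\<Sum>k\<le>n. (n - k) choose Suc k)) + fib_conv 0 n"
    by (simp add: fib_conv_def sum.distrib)
  also have "1 + (\<Sum>k\<le>n. (n - k) choose Suc k) = fib_conv 0 (Suc n)"
    unfolding fib_conv_def by (subst sum.atMost_Suc_shift) simp
  finally show ?thesis .
qed

text \<open>Pascal's rule is applied to the first factor, which splits off
  \<open>fib_conv q\<close>, and then to the second factor of the rest. This is
  \<open>G^(q + 2) * (1 - X - X^2) = G^(q + 1)\<close> in coefficients.\<close>

lemma fib_conv_rec:
  "fib_conv (Suc q) (Suc (Suc n)) =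
     fib_conv q (Suc (Suc n)) + fib_conv (Suc q) (Suc n) + fib_conv (Suc q) n"
proof -
  let ?N = "Suc (Suc n)"
  have "fib_conv (Suc q) ?N =
      (\<Sum>k\<le>?N. (((q + ?N - k) choose q) + ((q + ?N - k) choose Suc q)) * ((?N - k) choose k))"
    unfolding fib_conv_def by (rule sum.cong) (auto simp: Suc_diff_le)
  also have "\<dots> = fib_conv q ?N + (\<Sum>k\<le>?N. ((q + ?N - k) choose Suc q) * ((?N - k) choose k))"
    by (simp only: fib_conv_def sum.distrib[symmetric] distrib_right)
  also have "(\<Sum>k\<le>?N. ((q + ?N - k) choose Suc q) * ((?N - k) choose k)) =
      (\<Sum>k\<le>Suc n. ((q + ?N - k) choose Suc q) * ((?N - k) choose k))"
    \<comment> \<open>The top term vanishes, as its second factor is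
      \<open>0 choose ?N\<close>.\<close>
    by (subst sum.atMost_Suc) simp
  also have "\<dots> = ((q + ?N) choose Suc q) +
      (\<Sum>k\<le>n. ((q + Suc n - k) choose Suc q) * (Suc (n - k) choose Suc k))"
    by (subst sum.atMost_Suc_shift) (auto intro!: sum.cong simp: Suc_diff_le)
  also have "\<dots> = (((q + ?N) choose Suc q) +
      (\<Sum>k\<le>n. ((q + Suc n - k) choose Suc q) * ((n - k) choose Suc k))) + fib_conv (Suc q) n"
    by (simp add: fib_conv_def sum.distrib distrib_left)
  also have "((q + ?N) choose Suc q) +
      (\<Sum>k\<le>n. ((q + Suc n - k) choose Suc q) * ((n - k) choose Suc k)) = fib_conv (Suc q) (Suc n)"
    unfolding fib_conv_def by (subst sum.atMost_Suc_shift) simp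
  finally show ?thesis by simp
qed

lemma fps_nth_fib_mult:
  fixes F :: "real fps"
  shows "fps_nth (F * (1 - fps_X - fps_X\<^sup>2)) 0 = fps_nth F 0"
    and "fps_nth (F * (1 - fps_X - fps_X\<^sup>2)) (Suc 0) = fps_nth F 1 - fps_nth F 0"
    and "fps_nth (F * (1 - fps_X - fps_X\<^sup>2)) (Suc (Suc n)) =
           fps_nth F (Suc (Suc n)) - fps_nth F (Suc n) - fps_nth F n"
proof -
  have "F * (1 - fps_X - fps_X\<^sup>2) = F - fps_X * F - fps_X * (fps_X * F)"
    by (simp add: algebra_simps power2_eq_square)
  then show "fps_nth (F * (1 - fps_X - fps_X\<^sup>2)) 0 = fps_nth F 0"
    and "fps_nth (F * (1 - fps_X - fps_X\<^sup>2)) (Suc 0) = fps_nth F 1 - fps_nth F 0"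
    and "fps_nth (F * (1 - fps_X - fps_X\<^sup>2)) (Suc (Suc n)) =
           fps_nth F (Suc (Suc n)) - fps_nth F (Suc n) - fps_nth F n"
    by simp_all
qed

lemma fib_fps_cancel:
  assumes "F * (1 - fps_X - fps_X\<^sup>2) = H"
  shows "F = fib_fps * H"
proof -
  have "F = F * (fib_fps * (1 - fps_X - fps_X\<^sup>2))"
    by (simp only: fib_fps_inverse mult_1_right)
  also have "\<dots> = fib_fps * H"
    by (simp only: assms[symmetric] ac_simps)
  finally show ?thesis .
qed

lemma fib_conv_fps: "Abs_fps (\<lambda>n. real (fib_conv q n)) = fib_fps ^ Suc q"
proof (induction q)
  case 0
  have "Abs_fps (\<lambda>n. real (fib_conv 0 n)) * (1 - fps_X - fps_X\<^sup>2) = 1"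
  proof (rule fps_ext)
    fix n show "fps_nth (Abs_fps (\<lambda>n. real (fib_conv 0 n)) * (1 - fps_X - fps_X\<^sup>2)) n = fps_nth 1 n"
    proof (cases n rule: nat.exhaust[case_names zero suc])
      case (suc m)
      then show ?thesis
        by (cases m) (simp_all only: fps_nth_fib_mult, simp_all add: fib_conv_0_rec, simp add: fib_conv_def)
    qed (simp only: fps_nth_fib_mult, simp add: fib_conv_def)
  qed
  from fib_fps_cancel[OF this] show ?case by simp
next
  case (Suc q)
  have "Abs_fps (\<lambda>n. real (fib_conv (Suc q) n)) * (1 - fps_X - fps_X\<^sup>2) = fib_fps ^ Suc q"
    unfolding Suc.IH[symmetric]
  proof (rule fps_ext)
    fix n show "fps_nth (Abs_fps (\<lambda>n. real (fib_conv (Suc q) n)) * (1 - fps_X - fps_X\<^sup>2)) n =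
        fps_nth (Abs_fps (\<lambda>n. real (fib_conv q n))) n"
    proof (cases n rule: nat.exhaust[case_names zero suc])
      case (suc m)
      then show ?thesis
        by (cases m) (simp_all only: fps_nth_fib_mult, simp_all add: fib_conv_rec, simp add: fib_conv_def)
    qed (simp only: fps_nth_fib_mult, simp add: fib_conv_def)
  qed
  from fib_fps_cancel[OF this] show ?case by simp
qed

text \<open>Differentiating \<open>G * (1 - X - X^2) = 1\<close> gives
  \<open>G' = (1 + 2 X) G^2\<close>.\<close>

lemma fib_fps_power_deriv:
  "fps_deriv (fib_fps ^ N) = of_nat N * (1 + 2 * fps_X) * fib_fps ^ Suc N"
proof -
  have d: "fps_deriv fib_fps = (1 + 2 * fps_X) * fib_fps\<^sup>2"
  proof -
    have "fps_deriv fib_fps * (1 - fps_X - fps_X\<^sup>2) + fib_fps * (- 1 - 2 * fps_X) = 0"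
      using arg_cong[OF fib_fps_inverse, of fps_deriv] by (simp add: power2_eq_square algebra_simps)
    then have "fps_deriv fib_fps * (fib_fps * (1 - fps_X - fps_X\<^sup>2)) = (1 + 2 * fps_X) * fib_fps\<^sup>2"
      by algebra
    then show ?thesis by (simp add: fib_fps_inverse)
  qed
  show ?thesis
    by (induction N) (simp_all add: d power2_eq_square algebra_simps)
qed

lemma fib_fps_power_step: "fib_fps ^ Suc N * (1 - fps_X - fps_X\<^sup>2) = fib_fps ^ N"
  using fib_fps_inverse by (simp add: mult.assoc mult.left_commute)

section \<open>The series \<open>A\<close> and Lagrange inversion\<close>

lemma ex_tern_fps: "\<exists>A :: real fps. A * (1 - fps_X * A - fps_X\<^sup>2 * A\<^sup>2) = 1"
proof -
  define p :: "real fps" where "p = fps_X * (1 - fps_X - fps_X\<^sup>2)"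
  define f where "f = fps_inv p"
  have p: "fps_nth p 0 = 0" "fps_nth p 1 = 1" by (simp_all add: p_def)
  have f0: "fps_nth f 0 = 0" by (simp add: f_def fps_inv_def)
  have "p oo f = fps_X" unfolding f_def using fps_inv_right[of p] p by simp
  then have 1: "f * (1 - f - f\<^sup>2) = fps_X"
    using f0 by (simp add: p_def fps_compose_mult_distrib fps_compose_sub_distrib
        fps_compose_power[symmetric])
  \<comment> \<open>\<open>f\<close> has no constant term, so it is divisible by \<open>X\<close>;
    cancelling \<open>X\<close> in the equation for \<open>f\<close> leaves the one for
    \<open>A\<close>.\<close>
  define A where "A = fps_shift 1 f"
  have f: "f = fps_X * A"
  proof (rule fps_ext)
    fix n show "fps_nth f n = fps_nth (fps_X * A) n"
      using f0 by (cases n) (simp_all add: A_def)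
  qed
  have "fps_X * (A * (1 - fps_X * A - fps_X\<^sup>2 * A\<^sup>2)) = fps_X * 1"
    using 1 by (simp add: f power_mult_distrib mult.assoc)
  then show ?thesis by (metis mult_cancel_left fps_X_neq_zero)
qed

text \<open>The generating function of the sequence to be computed: \<open>A = 1 + X A\<^sup>2 + X\<^sup>2 A\<^sup>3\<close>.\<close>
definition tern_fps :: "real fps" where
  "tern_fps = (SOME A. A * (1 - fps_X * A - fps_X\<^sup>2 * A\<^sup>2) = 1)"

lemma tern_fps_inverse: "tern_fps * (1 - fps_X * tern_fps - fps_X\<^sup>2 * tern_fps\<^sup>2) = 1"
  unfolding tern_fps_def using someI_ex[OF ex_tern_fps] .

lemma tern_fps_0: "fps_nth tern_fps 0 = 1"
  using arg_cong[OF tern_fps_inverse, of "\<lambda>F. fps_nth F 0"] by simp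

lemma tern_fps_power_Suc:
  "tern_fps ^ Suc p = tern_fps ^ p + fps_X * (tern_fps ^ Suc (Suc p) + fps_X * tern_fps ^ Suc (Suc (Suc p)))"
proof -
  have "tern_fps ^ p * (tern_fps * (1 - fps_X * tern_fps - fps_X\<^sup>2 * tern_fps\<^sup>2)) =
      tern_fps ^ Suc p - fps_X * (tern_fps ^ Suc (Suc p) + fps_X * tern_fps ^ Suc (Suc (Suc p)))"
    by (simp add: algebra_simps power2_eq_square)
  then show ?thesis by (simp only: tern_fps_inverse mult_1_right eq_diff_eq)
qed

lemma fib_fps_power_nth_0: "fps_nth (fib_fps ^ N) 0 = 1"
  by (simp add: fib_fps_def fps_power_zeroth)

lemma fib_fps_power_Suc_nth:
  "real (Suc m) * fps_nth (fib_fps ^ N) (Suc m) =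
     real N * (fps_nth (fib_fps ^ Suc N) m + 2 * fps_nth (fps_X * fib_fps ^ Suc N) m)"
proof -
  have "fps_deriv (fib_fps ^ N) =
      fps_const (real N) * (fib_fps ^ Suc N + fps_const 2 * (fps_X * fib_fps ^ Suc N))"
    unfolding fib_fps_power_deriv by (simp add: fps_of_nat numeral_fps_const[symmetric] algebra_simps)
  from arg_cong[OF this, of "\<lambda>F. fps_nth F m"] show ?thesis
    by (simp only: fps_mult_left_const_nth fps_deriv_nth fps_add_nth) simp
qed

text \<open>The numbers \<open>p / (n + p) * fps_nth (fib_fps ^ (n + p)) n\<close> given by Lagrange inversion obey the
  recurrence of \<open>tern_fps_power_Suc\<close>. The last summand is written with \<open>fps_X\<close> so that it vanishes at
  \<open>m = 0\<close>.\<close>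
lemma lagrange_convolution:
  fixes m p :: nat
  defines "N \<equiv> Suc m + Suc p"
  defines "c \<equiv> \<lambda>n q. fps_nth (fib_fps ^ q) n"
  shows "real (Suc p) / real N * c (Suc m) N =
      real p / real (N - 1) * c (Suc m) (N - 1) + real (p + 2) / real N * c m N +
      real (p + 3) / real N * fps_nth (fps_X * fib_fps ^ N) m"
proof -
  define g where "g = fib_fps ^ N"
  define c0 c1 c2 where "c0 = fps_nth g (Suc m)" and "c1 = fps_nth g m"
    and "c2 = fps_nth (fps_X * g) m"
  have N: "N = Suc (N - 1)" by (simp add: N_def)
  \<comment> \<open>Every coefficient is reduced to those of the single power \<open>g\<close>; here
    \<open>G^(N - 1) = g * (1 - X - X^2)\<close>.\<close>
  have prev: "c (Suc m) (N - 1) = c0 - c1 - c2"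
  proof -
    have "fib_fps ^ (N - 1) = g - fps_X * g - fps_X * (fps_X * g)"
      using fib_fps_power_step[of "N - 1"] N by (simp add: g_def algebra_simps power2_eq_square)
    then show ?thesis by (simp add: c_def c0_def c1_def c2_def)
  qed
  have e1: "real (Suc m) * c (Suc m) (N - 1) = real (N - 1) * (c1 + 2 * c2)"
    using fib_fps_power_Suc_nth[of m "N - 1"] N
    by (simp only: c_def g_def c1_def c2_def)
  \<comment> \<open>The differential equation \<open>g' * (1 - X - X^2) = N (1 + 2 X) g\<close>
    links three successive coefficients of \<open>g\<close>.\<close>
  have e2: "real (Suc m) * c0 = real N * (c1 + 2 * c2) + real m * c1 + (real m - 1) * c2"
  proof -
    have "fps_deriv g * (1 - fps_X - fps_X\<^sup>2) = of_nat N * (1 + 2 * fps_X) * g"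
      unfolding g_def fib_fps_power_deriv mult.assoc fib_fps_power_step ..
    then have "fps_deriv g = fps_X * fps_deriv g + fps_X * (fps_X * fps_deriv g) +
        fps_const (real N) * (g + fps_const 2 * (fps_X * g))"
      by (simp add: fps_of_nat numeral_fps_const[symmetric] algebra_simps power2_eq_square)
    from arg_cong[OF this, of "\<lambda>F. fps_nth F m"] show ?thesis
      by (cases m; cases "m - 1") (simp_all add: c0_def c1_def c2_def algebra_simps)
  qed
  have N0: "real N > 0" "real (N - 1) > 0" by (simp_all add: N_def)
  have rN: "real N = real m + real p + 2" "real (N - 1) = real m + real p + 1" by (simp_all add: N_def)
  have "c (Suc m) (N - 1) / real (N - 1) * real (Suc m) =
      (real (Suc m) * c (Suc m) (N - 1)) / real (N - 1)" by simp
  also have "\<dots> = c1 + 2 * c2" unfolding e1 using N0 by simp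
  finally have x: "c (Suc m) (N - 1) / real (N - 1) * real (Suc m) = c1 + 2 * c2" .
  \<comment> \<open>This form of \<open>p\<close> lets \<open>e1\<close> cancel the denominator
    \<open>N - 1\<close>.\<close>
  have pm: "real p = real (N - 1) - real (Suc m)" by (simp add: N_def)
  have "real p / real (N - 1) * c (Suc m) (N - 1) =
      c (Suc m) (N - 1) - c (Suc m) (N - 1) / real (N - 1) * real (Suc m)"
    unfolding pm using N0(2) by (simp add: diff_divide_distrib left_diff_distrib del: of_nat_Suc)
  also have "\<dots> = c0 - 2 * c1 - 3 * c2" unfolding x unfolding prev by simp
  finally have y: "real p / real (N - 1) * c (Suc m) (N - 1) = c0 - 2 * c1 - 3 * c2" .
  have z: "real (Suc p) * c0 = real N * (c0 - 2 * c1 - 3 * c2) + real (p + 2) * c1 + real (p + 3) * c2"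
    using e2 by (simp add: rN algebra_simps)
  have "real (Suc p) / real N * c0 = (real (Suc p) * c0) / real N" by simp
  also have "\<dots> = c0 - 2 * c1 - 3 * c2 + real (p + 2) / real N * c1 + real (p + 3) / real N * c2"
    unfolding z using N0(1) by (simp add: add_divide_distrib distrib_left distrib_right)
  finally show ?thesis unfolding y by (simp add: c0_def c1_def c2_def c_def g_def)
qed

text \<open>Lagrange inversion for this series, verified by induction on \<open>n\<close> and,
  inside, on \<open>p\<close>. The assumption excludes \<open>n = p = 0\<close>, where the right
  side is 0 by division by zero and the left side is 1.\<close>

lemma tern_fps_power_nth:
  assumes "n + p > 0"
  shows "fps_nth (tern_fps ^ p) n = real p / real (n + p) * fps_nth (fib_fps ^ (n + p)) n"
  using assms
proof (induction n arbitrary: p rule: less_induct)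
  case (less n)
  note IHn = less.IH
  show ?case
  proof (cases n)
    case 0
    then show ?thesis using less.prems
      by (simp only: fib_fps_power_nth_0) (simp add: fps_power_zeroth tern_fps_0)
  next
    case n: (Suc m)
    show ?thesis
    proof (induction p)
      case 0
      then show ?case by (simp add: n)
    next
      case (Suc p)
      \<comment> \<open>Lowering \<open>n\<close> while raising \<open>p\<close> by the same amount
        keeps the exponent \<open>n + Suc p\<close> of \<open>G\<close>.\<close>
      have 1: "fps_nth (tern_fps ^ Suc (Suc p)) m = real (p + 2) / real (n + Suc p) * fps_nth (fib_fps ^ (n + Suc p)) m"
        using IHn[of m "Suc (Suc p)"] by (simp add: n del: power_Suc)
      have 2: "fps_nth (fps_X * tern_fps ^ Suc (Suc (Suc p))) m =
          real (p + 3) / real (n + Suc p) * fps_nth (fps_X * fib_fps ^ (n + Suc p)) m"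
      proof (cases m)
        case (Suc l)
        then show ?thesis using IHn[of l "Suc (Suc (Suc p))"] by (simp add: n numeral_3_eq_3 del: power_Suc)
      qed simp
      have "fps_nth (tern_fps ^ Suc p) n = fps_nth (tern_fps ^ p) n +
          (fps_nth (tern_fps ^ Suc (Suc p)) m + fps_nth (fps_X * tern_fps ^ Suc (Suc (Suc p))) m)"
        by (subst tern_fps_power_Suc) (simp add: n del: power_Suc)
      also have "\<dots> = real (Suc p) / real (n + Suc p) * fps_nth (fib_fps ^ (n + Suc p)) n"
        unfolding 1 2 Suc.IH using lagrange_convolution[of p m] by (simp add: n)
      finally show ?case .
    qed
  qed
qed

lemma tern_fps_nth:
  "fps_nth tern_fps n =
     (\<Sum>k=0..n div 2. 1 / (real n + 1) * real ((2 * n - k) choose (n + k)) * real ((n + k) choose k))"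
proof -
  \<comment> \<open>Both products equal \<open>(2n - k)! / (n! k! (n - 2k)!)\<close>.\<close>
  have eq: "((n + n - k) choose n) * ((n - k) choose k) = ((2 * n - k) choose (n + k)) * ((n + k) choose k)"
    if "k \<le> n div 2" for k
  proof -
    have "((2 * n - k) choose (n + k)) * ((n + k) choose n) = ((2 * n - k) choose n) * ((2 * n - k - n) choose (n + k - n))"
      using that by (intro choose_mult) auto
    moreover have "(n + k) choose n = (n + k) choose k" by (metis add_diff_cancel_left' binomial_symmetric le_add1)
    ultimately show ?thesis by (simp add: mult_2)
  qed
  have "fps_nth tern_fps n = 1 / (real n + 1) * fps_nth (fib_fps ^ Suc n) n"
    using tern_fps_power_nth[of n 1] by simp
  also have "fps_nth (fib_fps ^ Suc n) n = real (fib_conv n n)"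
    by (metis fib_conv_fps fps_nth_Abs_fps)
  also have "fib_conv n n = (\<Sum>k=0..n div 2. ((n + n - k) choose n) * ((n - k) choose k))"
    \<comment> \<open>For \<open>k > n div 2\<close> the factor \<open>(n - k) choose k\<close> is
      0.\<close>
    unfolding fib_conv_def by (rule sum.mono_neutral_right) (auto simp: binomial_eq_0)
  also have "\<dots> = (\<Sum>k=0..n div 2. ((2 * n - k) choose (n + k)) * ((n + k) choose k))"
    by (rule sum.cong) (simp_all add: eq)
  finally show ?thesis by (simp add: sum_distrib_left mult.assoc)
qed

section \<open>Counting prefixes by height\<close>

text \<open>The generating function of the prefixes ending at height \<open>h\<close>. The base of the power is
  \<open>1 - 1 / A\<close>, a root of the characteristic equation of the recurrence in \<open>h\<close>.\<close>
definition tail_fps :: "nat \<Rightarrow> real fps" where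
  "tail_fps h = tern_fps * (fps_X * tern_fps + fps_X\<^sup>2 * tern_fps\<^sup>2) ^ h"

lemma tail_fps_0: "tail_fps 0 = tern_fps"
  by (simp add: tail_fps_def)

text \<open>The base \<open>1 - 1 / A\<close> of the power differs from 1 by
  \<open>1 / A\<close>.\<close>

lemma tail_fps_telescope: "tern_fps * tail_fps h - tern_fps * tail_fps (Suc h) = tail_fps h"
proof -
  have "tern_fps * tail_fps h - tern_fps * tail_fps (Suc h) =
      tail_fps h * (tern_fps * (1 - fps_X * tern_fps - fps_X\<^sup>2 * tern_fps\<^sup>2))"
    by (simp add: tail_fps_def algebra_simps)
  then show ?thesis by (simp only: tern_fps_inverse mult_1_right)
qed

text \<open>The base is divisible by \<open>X\<close>, so \<open>X^h\<close> divides
  \<open>tail_fps h\<close>. The factor \<open>F\<close> allows use with both \<open>1\<close> and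
  \<open>A\<close>.\<close>

lemma tail_fps_nth_less:
  assumes "m < h"
  shows "fps_nth (F * tail_fps h) m = 0"
proof -
  have "F * tail_fps h = fps_X ^ h * (F * tern_fps * (tern_fps + fps_X * tern_fps\<^sup>2) ^ h)"
    by (simp add: tail_fps_def power_mult_distrib[symmetric] algebra_simps power2_eq_square)
  then show ?thesis using assms by (simp only: fps_X_power_mult_nth if_True)
qed

text \<open>Evaluates the sum over the additional east steps of a tile. It telescopes, and the
  remainder is divisible by \<open>X^(h + m + 1)\<close>.\<close>

lemma sum_tail_fps_nth:
  "(\<Sum>i\<le>m. fps_nth (tail_fps (h + i)) m) = fps_nth (tern_fps * tail_fps h) m"
proof -
  have "(\<Sum>i\<le>k. tail_fps (h + i)) = tern_fps * tail_fps h - tern_fps * tail_fps (h + Suc k)" for k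
  proof (induction k)
    case 0
    then show ?case by (simp add: tail_fps_telescope)
  next
    case (Suc k)
    have "(\<Sum>i\<le>Suc k. tail_fps (h + i)) =
        (tern_fps * tail_fps h - tern_fps * tail_fps (h + Suc k)) +
        (tern_fps * tail_fps (h + Suc k) - tern_fps * tail_fps (Suc (h + Suc k)))"
      by (simp only: tail_fps_telescope[of "h + Suc k"] sum.atMost_Suc Suc.IH)
    then show ?case by simp
  qed
  from arg_cong[OF this[of m], of "\<lambda>F. fps_nth F m"] show ?thesis
    by (simp add: fps_sum_nth tail_fps_nth_less)
qed

text \<open>The summand \<open>1\<close> accounts for the empty path.\<close>

lemma tail_fps_rec_0: "tail_fps 0 = tail_fps 1 + 1"
  using tern_fps_inverse by (simp add: tail_fps_def algebra_simps)

text \<open>With \<open>l = 1 - 1 / A\<close> this is \<open>l (1 - l) = l / A = X + X^2 A\<close>,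
  multiplied by \<open>tail_fps h\<close>.\<close>

lemma tail_fps_rec_Suc:
  "tail_fps (Suc h) = tail_fps (Suc (Suc h)) + fps_X * tail_fps h + fps_X\<^sup>2 * (tern_fps * tail_fps h)"
proof -
  define l where "l = fps_X * tern_fps + fps_X\<^sup>2 * tern_fps\<^sup>2"
  have 1: "tern_fps * (1 - l) = 1" using tern_fps_inverse by (simp add: l_def algebra_simps)
  have "l * (1 - l) = (fps_X + fps_X\<^sup>2 * tern_fps) * (tern_fps * (1 - l))"
    by (simp add: l_def[symmetric] algebra_simps power2_eq_square) (simp add: l_def algebra_simps power2_eq_square)
  then have "l * (1 - l) = fps_X + fps_X\<^sup>2 * tern_fps" by (simp only: 1 mult_1_right)
  then have "tail_fps h * (l * (1 - l)) = tail_fps h * (fps_X + fps_X\<^sup>2 * tern_fps)" by simp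
  moreover have "tail_fps (Suc h) = tail_fps h * l" for h by (simp add: tail_fps_def l_def)
  ultimately show ?thesis by (simp add: algebra_simps)
qed

lemma valid_prefixes_count:
  "finite (valid_prefixes m h) \<and> real (card (valid_prefixes m h)) = fps_nth (tail_fps h) m"
proof (induction m arbitrary: h rule: less_induct)
  case (less m)
  note IH = less.IH
  show ?case
  \<comment> \<open>Downward induction on \<open>h\<close>: the east step case refers to height
    \<open>h + 1\<close> at the same \<open>m\<close>, and above height \<open>m\<close> both sides
    are 0.\<close>
  proof (induction "Suc m - h" arbitrary: h rule: less_induct)
    case less
    show ?case
    proof (cases "m < h")
      case True
      then show ?thesis
        using tail_fps_nth_less[of m h 1] by (simp add: valid_prefixes_empty)
    next
      case False
      then have next_h: "finite (valid_prefixes m (Suc h))"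
        "real (card (valid_prefixes m (Suc h))) = fps_nth (tail_fps (Suc h)) m"
        using less[of "Suc h"] by auto
      show ?thesis
      proof (cases m)
        case 0
        then show ?thesis using False by (simp add: valid_prefixes_0_0 tail_fps_0 tern_fps_0)
      next
        case m: (Suc k)
        show ?thesis
        proof (cases h)
          case 0
          then show ?thesis
            using next_h by (simp add: m valid_prefixes_Suc_0 tail_fps_rec_0 card_image inj_on_def)
        next
          case h: (Suc h')
          have k: "finite (valid_prefixes k h')"
              "real (card (valid_prefixes k h')) = fps_nth (tail_fps h') k"
            using IH[of k h'] by (simp_all add: m)
          have l: "finite (valid_prefixes l i)"
              "real (card (valid_prefixes l i)) = fps_nth (tail_fps i) l" if "k = Suc l" for l i
            using IH[of l i] that by (simp_all add: m)
          \<comment> \<open>The factor \<open>X^2\<close> stands for the two north steps of a tile,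
            and \<open>A * tail_fps h'\<close> for the sum over its additional east steps.\<close>
          have "fps_nth (fps_X\<^sup>2 * (tern_fps * tail_fps h')) m =
              (case k of 0 \<Rightarrow> 0 | Suc l \<Rightarrow> \<Sum>i\<le>l. fps_nth (tail_fps (h' + i)) l)"
            by (simp add: m sum_tail_fps_nth fps_X_power_mult_nth split: nat.split)
          also have "\<dots> = real (case k of 0 \<Rightarrow> 0 | Suc l \<Rightarrow> \<Sum>i\<le>l. card (valid_prefixes l (h' + i)))"
            by (simp add: l split: nat.split)
          finally have swap: "fps_nth (fps_X\<^sup>2 * (tern_fps * tail_fps h')) m = \<dots>" .
          have "fps_nth (tail_fps h) m = fps_nth (tail_fps (Suc h)) m + fps_nth (tail_fps h') k +
              fps_nth (fps_X\<^sup>2 * (tern_fps * tail_fps h')) m"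
            unfolding h tail_fps_rec_Suc[of h'] by (simp add: m)
          then show ?thesis
            using card_valid_prefixes_Suc_Suc[of k h'] next_h k l swap by (simp add: m h)
        qed
      qed
    qed
  qed
qed

theorem theorem17:
  fixes n :: nat
  assumes "n \<ge> 1"
  shows "real (pf n {[2,3,1], [3,1,2], [3,2,1]}) =
    (\<Sum>k=0..n div 2. 1 / (real n + 1) * real ((2 * n - k) choose (n + k)) * real ((n + k) choose k))"
  unfolding pf_231_312_321_eq_card valid_prefixes_count[THEN conjunct2] tail_fps_0
  by (rule tern_fps_nth)

end
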